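(* Let $(G,q_1,\theta_1)$ and $(\Gamma,q_2,\theta_2)$ be involutive metric groups with $|G|\neq|\Gamma|$, with $\mathcal{G}(q_1)=-\mathcal{G}(q_2)$, and with an isomorphism $(G^{\theta_1},q_1|_{G^{\theta_1}})\cong(\Gamma^{\theta_2},q_2|_{\Gamma^{\theta_2}})$, by means of which both are identified with one group $(U,q_0)$, regarded as a common subgroup of $G$ and $\Gamma$. With $J$, $\nu_m$ and $\mathcal{G}(q_1,q_2,v,m)$ as in the context, for all $m\in\mathbb{N}$, $u\in U$, $g\in G_*$, $\gamma\in\Gamma_*$: $$\nu_m((u,0))=\delta_{mu,0}\,q_0(u)^m,$$ $$\nu_m((u,\pi))=\frac{1}{|\Gamma|-|G|}\sum_{v\in U}\langle u,v\rangle|\mathcal{G}(q_1,q_2,v,m)|^2,$$ $$\nu_m(g)=\frac{1}{|\Gamma|-|G|}\sum_{v\in U}\langle g,v\rangle|\mathcal{G}(q_1,q_2,v,m)|^2+\delta_{mg,0}\,q_1(g)^m,$$ $$\nu_m(\gamma)=\frac{1}{|\Gamma|-|G|}\sum_{v\in U}\langle\gamma,v\rangle|\mathcal{G}(q_1,q_2,v,m)|^2-\delta_{m\gamma,0}\,q_2(\gamma)^m.$$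
   Context: A metric group $(G,q)$ is a finite abelian group $G$ with a map $q:G\to\mathbb{T}=\{z\in\mathbb{C}:|z|=1\}$ such that $q(-g)=q(g)$ and $\langle g,h\rangle_q=q(g+h)q(g)^{-1}q(h)^{-1}$ is a non-degenerate bicharacter. $\mathcal{G}(q)=\frac{1}{\sqrt{|G|}}\sum_{g\in G}q(g)$. An involutive metric group $(G,q,\theta)$ is a metric group with $\theta\in\mathrm{Aut}(G)$, $\theta^2=\mathrm{id}$, $q\circ\theta=q$; $G^\theta=\{g\in G:\theta(g)=g\}$. Subscripts on $\langle\cdot,\cdot\rangle$ and $\theta$ are suppressed. Put $a=1/\sqrt{|G|}$, $b=1/\sqrt{|\Gamma|}$. Fix $G_*\subset G$, $\Gamma_*\subset\Gamma$ with $G=U\sqcup G_*\sqcup\theta_1(G_* )$, $\Gamma=U\sqcup\Gamma_*\sqcup\theta_2(\Gamma_* )$. Let $J=(U\times\{0,\pi\})\sqcup G_*\sqcup\Gamma_*$. Involution on $J$: $\overline{(u,0)}=(-u,0)$, $\overline{(u,\pi)}=(-u,\pi)$; $\overline{g}=-g$ if $-g\in G_*$ and $\theta_1(-g)$ otherwise; $\overline{\gamma}=-\gamma$ if $-\gamma\in\Gamma_*$ and $\theta_2(-\gamma)$ otherwise. With blocks indexed by $U\times\{0\}$, $U\times\{\pi\}$, $G_*$, $\Gamma_*$ (rows $u,u,g,\gamma$; columns with primes): $$S=\begin{pmatrix} \frac{a-b}{2}\overline{\langle u,u'\rangle}& \frac{a+b}{2}\overline{\langle u,u'\rangle}&a\overline{\langle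 u,g'\rangle} &b\overline{\langle u,\gamma'\rangle}\\ \frac{a+b}{2}\overline{\langle u,u'\rangle}& \frac{a-b}{2}\overline{\langle u,u'\rangle}&a\overline{\langle u,g'\rangle} &-b\overline{\langle u,\gamma'\rangle}\\ a\overline{\langle g,u'\rangle}&a\overline{\langle g,u'\rangle}&a(\overline{\langle g,g'\rangle+\langle\theta(g),g'\rangle})&0\\ b\overline{\langle\gamma,u'\rangle}&-b\overline{\langle\gamma,u'\rangle}&0&-b(\overline{\langle\gamma,\gamma'\rangle+\langle\theta(\gamma),\gamma'\rangle}) \end{pmatrix},$$ $T=\mathrm{Diag}(q_0(u),q_0(u),q_1(g),q_2(\gamma))$. Write $0=(0,0)\in J$. $N_{x,y,z}=\sum_{w\in J}S_{w,x}S_{w,y}S_{w,z}/S_{0,w}$, $N_{x,y}^z=N_{x,y,\overline z}$, and $\nu_m(z)=\sum_{x,y\in J}N_{x,y}^z\,S_{0,x}S_{0,y}\left(T_{y,y}/T_{x,x}\right)^m$. For $v\in U$, $m\in\mathbb{Z}$, $$\mathcal{G}(q_1,q_2,v,m)=\frac{1}{\sqrt{|G|}}\sum_{g\in G}\langle v,g\rangle q_1(g)^m+\frac{1}{\sqrt{|\Gamma|}}\sum_{\gamma\in\Gamma}\langle v,\gamma\rangle q_2(\gamma)^m.$$ *)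

theory Defs
  imports "HOL-Analysis.Analysis"
begin

definition bichar :: "('g::ab_group_add \<Rightarrow> complex) \<Rightarrow> 'g \<Rightarrow> 'g \<Rightarrow> complex" where
  "bichar q g h = q (g + h) * inverse (q g) * inverse (q h)"

text \<open>Finite abelian groups are types of sort \<open>{ab_group_add, finite}\<close>.\<close>

definition metric_group :: "('g::{ab_group_add,finite} \<Rightarrow> complex) \<Rightarrow> bool" where
  "metric_group q \<longleftrightarrow>
     (\<forall>g. norm (q g) = 1) \<and>
     (\<forall>g. q (- g) = q g) \<and>
     (\<forall>g g' h. bichar q (g + g') h = bichar q g h * bichar q g' h) \<and>
     (\<forall>g h h'. bichar q g (h + h') = bichar q g h * bichar q g h') \<and>
     (\<forall>g. (\<forall>h. bichar q g h = 1) \<longrightarrow> g = 0)"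

definition gauss_sum :: "('g::{ab_group_add,finite} \<Rightarrow> complex) \<Rightarrow> complex" where
  "gauss_sum q = 1 / of_real (sqrt (real CARD('g))) * (\<Sum>g\<in>UNIV. q g)"

definition involutive_metric_group ::
    "('g::{ab_group_add,finite} \<Rightarrow> complex) \<Rightarrow> ('g \<Rightarrow> 'g) \<Rightarrow> bool" where
  "involutive_metric_group q \<theta> \<longleftrightarrow>
     metric_group q \<and> bij \<theta> \<and> Modules.additive \<theta> \<and> \<theta> \<circ> \<theta> = id \<and> q \<circ> \<theta> = q"

definition fixed_points :: "('g \<Rightarrow> 'g) \<Rightarrow> 'g set" where
  "fixed_points \<theta> = {g. \<theta> g = g}"

definition metric_iso_on ::
    "'g::ab_group_add set \<Rightarrow> ('g \<Rightarrow> complex) \<Rightarrow>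
     'h::ab_group_add set \<Rightarrow> ('h \<Rightarrow> complex) \<Rightarrow> ('g \<Rightarrow> 'h) \<Rightarrow> bool" where
  "metric_iso_on A q B r \<phi> \<longleftrightarrow>
     bij_betw \<phi> A B \<and> (\<forall>x\<in>A. \<forall>y\<in>A. \<phi> (x + y) = \<phi> x + \<phi> y) \<and> (\<forall>x\<in>A. r (\<phi> x) = q x)"

definition half_of_complement :: "('g \<Rightarrow> 'g) \<Rightarrow> 'g set \<Rightarrow> bool" where
  "half_of_complement \<theta> A \<longleftrightarrow>
     fixed_points \<theta> \<union> A \<union> \<theta> ` A = UNIV \<and>
     fixed_points \<theta> \<inter> A = {} \<and> fixed_points \<theta> \<inter> \<theta> ` A = {} \<and> A \<inter> \<theta> ` A = {}"

text \<open>
  In what follows, \<open>'g\<close> and \<open>'h\<close> are the types of \<open>G\<close> and \<open>\<Gamma>\<close>. The common subgroup \<open>U\<close> is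
  realised as the fixed point set of \<open>\<theta>\<^sub>1\<close> in \<open>'g\<close>, so that \<open>q\<^sub>0\<close> is the restriction of \<open>q\<^sub>1\<close>;
  an element \<open>u\<close> of \<open>U\<close>, regarded as an element of \<open>\<Gamma>\<close>, is \<open>\<phi> u\<close>, where \<open>\<phi>\<close> is the given
  isomorphism onto the fixed point set of \<open>\<theta>\<^sub>2\<close>. The labels \<open>(u, 0)\<close> and \<open>(u, \<pi>)\<close> are \<open>LZero u\<close>
  and \<open>LPi u\<close>.
\<close>

datatype ('g, 'h) label = LZero 'g | LPi 'g | LG 'g | LGamma 'h

definition label_set ::
    "('g \<Rightarrow> 'g) \<Rightarrow> 'g set \<Rightarrow> 'h set \<Rightarrow> ('g, 'h) label set" where
  "label_set \<theta>\<^sub>1 Gs \<Gamma>s =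
     LZero ` fixed_points \<theta>\<^sub>1 \<union> LPi ` fixed_points \<theta>\<^sub>1 \<union> LG ` Gs \<union> LGamma ` \<Gamma>s"

fun label_bar ::
    "('g::ab_group_add \<Rightarrow> 'g) \<Rightarrow> ('h::ab_group_add \<Rightarrow> 'h) \<Rightarrow> 'g set \<Rightarrow> 'h set \<Rightarrow>
     ('g, 'h) label \<Rightarrow> ('g, 'h) label" where
  "label_bar \<theta>\<^sub>1 \<theta>\<^sub>2 Gs \<Gamma>s (LZero u) = LZero (- u)"
| "label_bar \<theta>\<^sub>1 \<theta>\<^sub>2 Gs \<Gamma>s (LPi u) = LPi (- u)"
| "label_bar \<theta>\<^sub>1 \<theta>\<^sub>2 Gs \<Gamma>s (LG g) = LG (if - g \<in> Gs then - g else \<theta>\<^sub>1 (- g))"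
| "label_bar \<theta>\<^sub>1 \<theta>\<^sub>2 Gs \<Gamma>s (LGamma \<gamma>) = LGamma (if - \<gamma> \<in> \<Gamma>s then - \<gamma> else \<theta>\<^sub>2 (- \<gamma>))"

definition S_matrix ::
    "('g::{ab_group_add,finite} \<Rightarrow> complex) \<Rightarrow> ('g \<Rightarrow> 'g) \<Rightarrow>
     ('h::{ab_group_add,finite} \<Rightarrow> complex) \<Rightarrow> ('h \<Rightarrow> 'h) \<Rightarrow> ('g \<Rightarrow> 'h) \<Rightarrow>
     ('g, 'h) label \<Rightarrow> ('g, 'h) label \<Rightarrow> complex" where
  "S_matrix q\<^sub>1 \<theta>\<^sub>1 q\<^sub>2 \<theta>\<^sub>2 \<phi> x y =
     (let a = 1 / of_real (sqrt (real CARD('g))); b = 1 / of_real (sqrt (real CARD('h))) in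
      case (x, y) of
        (LZero u, LZero u') \<Rightarrow> (a - b) / 2 * cnj (bichar q\<^sub>1 u u')
      | (LZero u, LPi u') \<Rightarrow> (a + b) / 2 * cnj (bichar q\<^sub>1 u u')
      | (LZero u, LG g') \<Rightarrow> a * cnj (bichar q\<^sub>1 u g')
      | (LZero u, LGamma \<gamma>') \<Rightarrow> b * cnj (bichar q\<^sub>2 (\<phi> u) \<gamma>')
      | (LPi u, LZero u') \<Rightarrow> (a + b) / 2 * cnj (bichar q\<^sub>1 u u')
      | (LPi u, LPi u') \<Rightarrow> (a - b) / 2 * cnj (bichar q\<^sub>1 u u')
      | (LPi u, LG g') \<Rightarrow> a * cnj (bichar q\<^sub>1 u g')
      | (LPi u, LGamma \<gamma>') \<Rightarrow> - b * cnj (bichar q\<^sub>2 (\<phi> u) \<gamma>')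
      | (LG g, LZero u') \<Rightarrow> a * cnj (bichar q\<^sub>1 g u')
      | (LG g, LPi u') \<Rightarrow> a * cnj (bichar q\<^sub>1 g u')
      | (LG g, LG g') \<Rightarrow> a * cnj (bichar q\<^sub>1 g g' + bichar q\<^sub>1 (\<theta>\<^sub>1 g) g')
      | (LG g, LGamma \<gamma>') \<Rightarrow> 0
      | (LGamma \<gamma>, LZero u') \<Rightarrow> b * cnj (bichar q\<^sub>2 \<gamma> (\<phi> u'))
      | (LGamma \<gamma>, LPi u') \<Rightarrow> - b * cnj (bichar q\<^sub>2 \<gamma> (\<phi> u'))
      | (LGamma \<gamma>, LG g') \<Rightarrow> 0
      | (LGamma \<gamma>, LGamma \<gamma>') \<Rightarrow> - b * cnj (bichar q\<^sub>2 \<gamma> \<gamma>' + bichar q\<^sub>2 (\<theta>\<^sub>2 \<gamma>) \<gamma>'))"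

definition T_matrix ::
    "('g \<Rightarrow> complex) \<Rightarrow> ('h \<Rightarrow> complex) \<Rightarrow> ('g, 'h) label \<Rightarrow> ('g, 'h) label \<Rightarrow> complex" where
  "T_matrix q\<^sub>1 q\<^sub>2 x y =
     (if x = y then case x of LZero u \<Rightarrow> q\<^sub>1 u | LPi u \<Rightarrow> q\<^sub>1 u | LG g \<Rightarrow> q\<^sub>1 g | LGamma \<gamma> \<Rightarrow> q\<^sub>2 \<gamma>
      else 0)"

text \<open>\<open>fusion3 \<dots> x y z\<close> is \<open>N\<close> with the three lower indices \<open>x\<close>, \<open>y\<close>, \<open>z\<close>, whereas \<open>fusion \<dots> x y z\<close> has
  lower indices \<open>x\<close>, \<open>y\<close> and upper index \<open>z\<close>.\<close>

definition fusion3 ::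
    "('g::{ab_group_add,finite} \<Rightarrow> complex) \<Rightarrow> ('g \<Rightarrow> 'g) \<Rightarrow>
     ('h::{ab_group_add,finite} \<Rightarrow> complex) \<Rightarrow> ('h \<Rightarrow> 'h) \<Rightarrow> ('g \<Rightarrow> 'h) \<Rightarrow> 'g set \<Rightarrow> 'h set \<Rightarrow>
     ('g, 'h) label \<Rightarrow> ('g, 'h) label \<Rightarrow> ('g, 'h) label \<Rightarrow> complex" where
  "fusion3 q\<^sub>1 \<theta>\<^sub>1 q\<^sub>2 \<theta>\<^sub>2 \<phi> Gs \<Gamma>s x y z =
     (let S = S_matrix q\<^sub>1 \<theta>\<^sub>1 q\<^sub>2 \<theta>\<^sub>2 \<phi> in
      \<Sum>w\<in>label_set \<theta>\<^sub>1 Gs \<Gamma>s. S w x * S w y * S w z / S (LZero 0) w)"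

definition fusion ::
    "('g::{ab_group_add,finite} \<Rightarrow> complex) \<Rightarrow> ('g \<Rightarrow> 'g) \<Rightarrow>
     ('h::{ab_group_add,finite} \<Rightarrow> complex) \<Rightarrow> ('h \<Rightarrow> 'h) \<Rightarrow> ('g \<Rightarrow> 'h) \<Rightarrow> 'g set \<Rightarrow> 'h set \<Rightarrow>
     ('g, 'h) label \<Rightarrow> ('g, 'h) label \<Rightarrow> ('g, 'h) label \<Rightarrow> complex" where
  "fusion q\<^sub>1 \<theta>\<^sub>1 q\<^sub>2 \<theta>\<^sub>2 \<phi> Gs \<Gamma>s x y z =
     fusion3 q\<^sub>1 \<theta>\<^sub>1 q\<^sub>2 \<theta>\<^sub>2 \<phi> Gs \<Gamma>s x y (label_bar \<theta>\<^sub>1 \<theta>\<^sub>2 Gs \<Gamma>s z)"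

definition nu ::
    "('g::{ab_group_add,finite} \<Rightarrow> complex) \<Rightarrow> ('g \<Rightarrow> 'g) \<Rightarrow>
     ('h::{ab_group_add,finite} \<Rightarrow> complex) \<Rightarrow> ('h \<Rightarrow> 'h) \<Rightarrow> ('g \<Rightarrow> 'h) \<Rightarrow> 'g set \<Rightarrow> 'h set \<Rightarrow>
     nat \<Rightarrow> ('g, 'h) label \<Rightarrow> complex" where
  "nu q\<^sub>1 \<theta>\<^sub>1 q\<^sub>2 \<theta>\<^sub>2 \<phi> Gs \<Gamma>s m z =
     (let J = label_set \<theta>\<^sub>1 Gs \<Gamma>s; S = S_matrix q\<^sub>1 \<theta>\<^sub>1 q\<^sub>2 \<theta>\<^sub>2 \<phi>; T = T_matrix q\<^sub>1 q\<^sub>2 in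
      \<Sum>x\<in>J. \<Sum>y\<in>J. fusion q\<^sub>1 \<theta>\<^sub>1 q\<^sub>2 \<theta>\<^sub>2 \<phi> Gs \<Gamma>s x y z * S (LZero 0) x * S (LZero 0) y
                     * (T y y / T x x) ^ m)"

definition gauss_pair ::
    "('g::{ab_group_add,finite} \<Rightarrow> complex) \<Rightarrow> ('h::{ab_group_add,finite} \<Rightarrow> complex) \<Rightarrow>
     ('g \<Rightarrow> 'h) \<Rightarrow> 'g \<Rightarrow> int \<Rightarrow> complex" where
  "gauss_pair q\<^sub>1 q\<^sub>2 \<phi> v m =
     1 / of_real (sqrt (real CARD('g))) * (\<Sum>g\<in>UNIV. bichar q\<^sub>1 v g * q\<^sub>1 g powi m)
   + 1 / of_real (sqrt (real CARD('h))) * (\<Sum>\<gamma>\<in>UNIV. bichar q\<^sub>2 (\<phi> v) \<gamma> * q\<^sub>2 \<gamma> powi m)"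

definition nat_mult :: "nat \<Rightarrow> 'g::ab_group_add \<Rightarrow> 'g" where
  "nat_mult m x = (\<Sum>i<m. x)"

end

theory Submission
  imports Defs
begin

text \<open>
  Substituting the Verlinde formula into \<open>\<nu>\<^sub>m(z)\<close> and summing over \<open>x\<close> and \<open>y\<close> first gives
  \<open>\<Sum>\<^sub>w S\<^bsub>w,z'\<^esub> / S\<^bsub>0,w\<^esub> \<cdot> |R w|\<^sup>2\<close>, where \<open>z'\<close> is the conjugate label of \<open>z\<close> and
  \<open>R w = \<Sum>\<^sub>y S\<^bsub>w,y\<^esub> S\<^bsub>0,y\<^esub> T\<^sub>y\<^sup>m\<close>. Since \<open>q\<^sub>1\<close> and \<open>q\<^sub>2\<close> are invariant under the
  involutions, each \<open>R w\<close> is a combination of the sums \<open>X v = \<Sum>\<^sub>g \<langle>v, g\<rangle> q\<^sub>1(g)\<^sup>m\<close> and the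
  analogous \<open>Y v\<close> over \<open>\<Gamma>\<close>: it equals \<open>(a\<^sup>2 X u \<plusminus> b\<^sup>2 Y u) / 2\<close>, \<open>a\<^sup>2 X g\<close> or
  \<open>- b\<^sup>2 Y \<gamma>\<close>. Sums over the half \<open>G\<^sub>*\<close> are traded for sums over \<open>G\<close> and \<open>U\<close>; by
  orthogonality \<open>a\<^sup>4 \<Sum>\<^sub>g \<langle>g, x\<rangle> |X g|\<^sup>2\<close> is \<open>q\<^sub>1(x)\<^sup>m\<close> if \<open>m x = 0\<close> and \<open>0\<close> otherwise.
  The remaining sums over \<open>U\<close> recombine into \<open>|a X v + b Y v|\<^sup>2\<close>.
\<close>

lemma nat_mult_Suc: "nat_mult (Suc m) x = nat_mult m x + x"
  by (simp add: nat_mult_def)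

lemma cnj_eq_inverse: "cnj z = inverse z" if "norm z = 1"
  using that complex_norm_square[of z] inverse_unique[of z "cnj z"] by simp

section \<open>Characters of one involutive metric group\<close>

locale involutive_group =
  fixes q :: "'g::{ab_group_add,finite} \<Rightarrow> complex" and \<theta> :: "'g \<Rightarrow> 'g" and A :: "'g set"
  assumes involutive: "involutive_metric_group q \<theta>"
    and half: "half_of_complement \<theta> A"
begin

abbreviation ip :: "'g \<Rightarrow> 'g \<Rightarrow> complex" where "ip \<equiv> bichar q"
abbreviation U :: "'g set" where "U \<equiv> fixed_points \<theta>"

lemma norm_q: "norm (q g) = 1"
  and q_minus: "q (- g) = q g"
  and ip_add_left: "ip (g + g') h = ip g h * ip g' h"
  and ip_add_right: "ip g (h + h') = ip g h * ip g h'"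
  and ip_nondegenerate: "(\<And>h. ip g h = 1) \<Longrightarrow> g = 0"
proof -
  have "(\<forall>g. norm (q g) = 1) \<and> (\<forall>g. q (- g) = q g) \<and>
      (\<forall>g g' h. ip (g + g') h = ip g h * ip g' h) \<and>
      (\<forall>g h h'. ip g (h + h') = ip g h * ip g h') \<and> (\<forall>g. (\<forall>h. ip g h = 1) \<longrightarrow> g = 0)"
    using involutive unfolding involutive_metric_group_def metric_group_def by (elim conjE) (intro conjI)
  then show "norm (q g) = 1" "q (- g) = q g" "ip (g + g') h = ip g h * ip g' h"
    "ip g (h + h') = ip g h * ip g h'" "(\<And>h. ip g h = 1) \<Longrightarrow> g = 0"
    by simp_all
qed

lemma \<theta>_add: "\<theta> (g + h) = \<theta> g + \<theta> h"
  using involutive unfolding involutive_metric_group_def Modules.additive_def by simp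

lemma \<theta>_\<theta> [simp]: "\<theta> (\<theta> g) = g" and q_\<theta> [simp]: "q (\<theta> g) = q g"
  using involutive unfolding involutive_metric_group_def by (auto simp: fun_eq_iff)

lemma inj_\<theta>: "inj_on \<theta> B"
  by (rule inj_on_inverseI[of _ \<theta>]) simp

lemma \<theta>_zero [simp]: "\<theta> 0 = 0"
  using \<theta>_add[of 0 0] by simp

lemma \<theta>_minus: "\<theta> (- g) = - \<theta> g"
  using \<theta>_add[of g "- g"] by (simp add: add_eq_0_iff)

lemma zero_in_U [simp]: "0 \<in> U"
  by (simp add: fixed_points_def)

lemma q_nonzero [simp]: "q g \<noteq> 0"
  using norm_q[of g] by auto

lemma cnj_q: "cnj (q g) = inverse (q g)"
  by (simp add: cnj_eq_inverse norm_q)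

lemma ip_sym: "ip g h = ip h g"
  by (simp add: bichar_def add.commute)

lemma norm_ip: "norm (ip g h) = 1"
  by (simp add: bichar_def norm_mult norm_inverse norm_q)

lemma ip_nonzero [simp]: "ip g h \<noteq> 0"
  by (simp add: bichar_def)

lemma ip_zero_left [simp]: "ip 0 h = 1"
  using ip_add_left[of 0 0 h] by simp

lemma ip_minus_left: "ip (- g) h = cnj (ip g h)"
proof -
  have "ip (- g) h = inverse (ip g h)"
    using ip_add_left[of "- g" g h] by (simp add: field_simps)
  then show ?thesis
    by (simp add: cnj_eq_inverse norm_ip)
qed

lemma ip_minus_right: "ip g (- h) = cnj (ip g h)"
  by (metis ip_minus_left ip_sym)

lemma ip_\<theta>_\<theta>: "ip (\<theta> g) (\<theta> h) = ip g h"
  by (simp add: bichar_def flip: \<theta>_add)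

lemma ip_\<theta>_right: "ip g (\<theta> h) = ip (\<theta> g) h"
  using ip_\<theta>_\<theta>[of g "\<theta> h"] by simp

lemma ip_\<theta>_fixed: "u \<in> U \<Longrightarrow> ip u (\<theta> g) = ip u g"
  using ip_\<theta>_\<theta>[of u g] by (simp add: fixed_points_def)

lemma ip_\<theta>_fixed_left: "u \<in> U \<Longrightarrow> ip (\<theta> u) g = ip u g"
  by (simp add: fixed_points_def)

lemma ip_power: "ip g h ^ m = ip (nat_mult m g) h"
  by (induction m) (simp_all add: nat_mult_Suc ip_add_left nat_mult_def[of 0])

text \<open>For nonzero \<open>x\<close>, nondegeneracy supplies \<open>h\<close> with
  \<open>ip x h \<noteq> 1\<close>. Translating the summation variable by \<open>h\<close>
  multiplies the sum by \<open>ip x h\<close>, so it vanishes.\<close>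

lemma sum_ip: "(\<Sum>g\<in>UNIV. ip x g) = of_nat CARD('g) * of_bool (x = 0)"
proof (cases "x = 0")
  case False
  then obtain h where h: "ip x h \<noteq> 1"
    using ip_nondegenerate by blast
  have "(\<Sum>g\<in>UNIV. ip x g) = (\<Sum>g\<in>UNIV. ip x (g + h))"
    by (rule sum.reindex_bij_betw[symmetric])
      (auto intro!: bij_betwI[where g = "\<lambda>g. g - h"])
  also have "\<dots> = (\<Sum>g\<in>UNIV. ip x g) * ip x h"
    by (simp add: ip_add_right sum_distrib_right)
  finally show ?thesis
    using h False by simp
qed simp

section \<open>Sums over half of the complement of the fixed points\<close>

lemma sum_UNIV_split:
  fixes f :: "'g \<Rightarrow> complex"
  shows "(\<Sum>g\<in>UNIV. f g) = (\<Sum>g\<in>U. f g) + (\<Sum>g\<in>A. f g + f (\<theta> g))"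
proof -
  have *: "U \<union> A \<union> \<theta> ` A = UNIV" "U \<inter> A = {}" "U \<inter> \<theta> ` A = {}" "A \<inter> \<theta> ` A = {}"
    using half unfolding half_of_complement_def by auto
  have "sum f UNIV = sum f (U \<union> A \<union> \<theta> ` A)"
    using *(1) by simp
  also have "\<dots> = sum f (U \<union> A) + sum f (\<theta> ` A)"
    using * by (intro sum.union_disjoint) auto
  also have "sum f (U \<union> A) = sum f U + sum f A"
    using * by (intro sum.union_disjoint) auto
  also have "sum f (\<theta> ` A) = (\<Sum>g\<in>A. f (\<theta> g))"
    by (simp add: sum.reindex[OF inj_\<theta>])
  finally show ?thesis
    by (simp add: sum.distrib)
qed

text \<open>Outside \<open>U\<close> the orbits of \<theta> have two elements, exactly one of them
  in \<open>A\<close>, so \<open>A\<close> carries half of what an invariant function contributes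
  there.\<close>

lemma sum_half:
  fixes f :: "'g \<Rightarrow> complex"
  assumes "\<And>g. f (\<theta> g) = f g"
  shows "(\<Sum>g\<in>A. f g) = ((\<Sum>g\<in>UNIV. f g) - (\<Sum>g\<in>U. f g)) / 2"
  unfolding sum_UNIV_split assms sum.distrib by simp

section \<open>Fourier transforms and twisted Gauss sums\<close>

definition fourier :: "('g \<Rightarrow> complex) \<Rightarrow> 'g \<Rightarrow> complex" where
  "fourier r x = (\<Sum>g\<in>UNIV. cnj (ip x g) * r g)"

text \<open>\<open>fourier\<close> carries conjugated characters because the entries of the S-matrix
  do; replacing \<open>g\<close> by \<open>- g\<close> removes the conjugation.\<close>

lemma fourier_even:
  assumes "\<And>g. r (- g) = r g"
  shows "fourier r x = (\<Sum>g\<in>UNIV. ip x g * r g)"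
proof -
  have "fourier r x = (\<Sum>g\<in>UNIV. cnj (ip x (- g)) * r (- g))"
    unfolding fourier_def
    by (rule sum.reindex_bij_betw[symmetric]) (auto intro!: bij_betwI[where g = uminus])
  then show ?thesis
    by (simp add: assms ip_minus_right)
qed

text \<open>Since \<theta> preserves the pairing, it can be moved from \<open>x\<close> to the
  summation variable, where reindexing absorbs it.\<close>

lemma fourier_\<theta>:
  assumes "\<And>g. r (\<theta> g) = r g"
  shows "fourier r (\<theta> x) = fourier r x"
proof -
  have "fourier r x = (\<Sum>g\<in>UNIV. cnj (ip x (\<theta> g)) * r (\<theta> g))"
    unfolding fourier_def
    by (rule sum.reindex_bij_betw[symmetric]) (auto intro!: bij_betwI[where g = \<theta>])
  then show ?thesis
    by (simp add: fourier_def assms ip_\<theta>_right)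
qed

lemma fourier_split:
  "fourier r x = (\<Sum>u\<in>U. cnj (ip x u) * r u)
     + (\<Sum>g\<in>A. cnj (ip x g) * r g + cnj (ip x (\<theta> g)) * r (\<theta> g))"
  unfolding fourier_def by (rule sum_UNIV_split)

text \<open>The Gauss sum of \<open>q ^ m\<close> twisted by the character \<open>ip x\<close>, left
  unnormalised; the powers of the group order are collected separately.\<close>

definition gauss :: "nat \<Rightarrow> 'g \<Rightarrow> complex" where
  "gauss m x = (\<Sum>g\<in>UNIV. ip x g * q g ^ m)"

lemma fourier_q: "fourier (\<lambda>g. q g ^ m) x = gauss m x"
  unfolding gauss_def by (rule fourier_even) (simp add: q_minus)

lemma fourier_q_inverse: "fourier (\<lambda>g. inverse (q g) ^ m) x = cnj (gauss m x)"
  by (simp add: fourier_def gauss_def cnj_q)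

lemma gauss_\<theta>: "gauss m (\<theta> x) = gauss m x"
  using fourier_\<theta>[of "\<lambda>g. q g ^ m" x] by (simp add: fourier_q)

text \<open>Orthogonality is used twice. Expanding the square into a sum over \<open>h\<close> and
  \<open>k\<close> and summing over \<open>g\<close> forces \<open>h = x + k\<close>. The remaining
  sum over \<open>k\<close> is the character sum of \<open>nat_mult m x\<close>, which vanishes
  unless that element is zero.\<close>

lemma sum_ip_gauss_sq:
  "(\<Sum>g\<in>UNIV. ip g x * (gauss m g * cnj (gauss m g))) =
     (of_nat CARD('g))\<^sup>2 * (of_bool (nat_mult m x = 0) * q x ^ m)"
    (is "?L = _")
proof -
  have "?L = (\<Sum>g\<in>UNIV. \<Sum>h\<in>UNIV. \<Sum>k\<in>UNIV.
      ip g (x - h + k) * (q h ^ m * inverse (q k) ^ m))"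
  proof (rule sum.cong[OF refl])
    fix g
    \<comment> \<open>One factor is written with conjugated characters and the other without, so
      that the three characters of \<open>g\<close> merge into
      \<open>ip g (x - h + k)\<close>.\<close>
    have "cnj (gauss m g) = (\<Sum>k\<in>UNIV. ip g k * inverse (q k) ^ m)"
      unfolding fourier_q_inverse[symmetric]
      by (rule fourier_even) (simp add: q_minus)
    then have "ip g x * (gauss m g * cnj (gauss m g)) =
        ip g x * ((\<Sum>h\<in>UNIV. cnj (ip g h) * q h ^ m) * (\<Sum>k\<in>UNIV. ip g k * inverse (q k) ^ m))"
      using fourier_q[of m g] by (simp add: fourier_def)
    also have "\<dots> = (\<Sum>h\<in>UNIV. \<Sum>k\<in>UNIV.
        ip g x * ((cnj (ip g h) * q h ^ m) * (ip g k * inverse (q k) ^ m)))"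
      by (simp only: sum_product) (simp only: sum_distrib_left)
    also have "\<dots> = (\<Sum>h\<in>UNIV. \<Sum>k\<in>UNIV. ip g (x - h + k) * (q h ^ m * inverse (q k) ^ m))"
      unfolding diff_conv_add_uminus ip_add_right ip_minus_right by (simp only: mult_ac)
    finally show "ip g x * (gauss m g * cnj (gauss m g)) =
        (\<Sum>h\<in>UNIV. \<Sum>k\<in>UNIV. ip g (x - h + k) * (q h ^ m * inverse (q k) ^ m))" .
  qed
  also have "\<dots> = (\<Sum>h\<in>UNIV. \<Sum>k\<in>UNIV. \<Sum>g\<in>UNIV.
      ip g (x - h + k) * (q h ^ m * inverse (q k) ^ m))"
    by (subst sum.swap) (intro sum.cong refl sum.swap)
  also have "\<dots> = (\<Sum>h\<in>UNIV. \<Sum>k\<in>UNIV.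
      of_nat CARD('g) * of_bool (x - h + k = 0) * (q h ^ m * inverse (q k) ^ m))"
    by (simp add: ip_sym[of _ "x - _ + _"] sum_ip flip: sum_distrib_right)
  also have "\<dots> = (\<Sum>k\<in>UNIV. \<Sum>h\<in>UNIV.
      if h = x + k then of_nat CARD('g) * (q h ^ m * inverse (q k) ^ m) else 0)"
    by (subst sum.swap) (intro sum.cong refl, auto simp: algebra_simps)
  \<comment> \<open>By the definition of the pairing, \<open>q (x + k) = q x * q k * ip x k\<close>;
    the powers of \<open>q k\<close> cancel.\<close>
  also have "\<dots> = (\<Sum>k\<in>UNIV. of_nat CARD('g) * (q x ^ m * ip (nat_mult m x) k))"
    unfolding ip_power[symmetric]
    by (simp add: bichar_def power_mult_distrib power_inverse field_simps)
  also have "\<dots> = (of_nat CARD('g))\<^sup>2 * (of_bool (nat_mult m x = 0) * q x ^ m)"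
    by (simp add: sum_ip power2_eq_square flip: sum_distrib_left)
  finally show ?thesis .
qed

text \<open>Against a fixed point \<open>u\<close> the pairing does not distinguish \<open>g\<close>
  from \<open>\<theta> g\<close>, so the summand is invariant and halving applies.\<close>

lemma sum_half_fixed:
  assumes "u \<in> U"
  shows "(\<Sum>g\<in>A. ip g u * (gauss m g * cnj (gauss m g))) =
    ((\<Sum>g\<in>UNIV. ip g u * (gauss m g * cnj (gauss m g)))
      - (\<Sum>v\<in>U. ip v u * (gauss m v * cnj (gauss m v)))) / 2"
proof (rule sum_half)
  fix g
  have "ip (\<theta> g) u = ip g u"
    using assms ip_\<theta>_fixed[of u g] by (simp add: ip_sym)
  then show "ip (\<theta> g) u * (gauss m (\<theta> g) * cnj (gauss m (\<theta> g))) =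
      ip g u * (gauss m g * cnj (gauss m g))"
    by (simp add: gauss_\<theta>)
qed

text \<open>For arbitrary \<open>x\<close> only the Gauss sum is invariant; the two pairings, as
  they occur in the S-matrix, cover the whole orbit and no factor 1/2 appears.\<close>

lemma sum_half_orbit:
  "(\<Sum>g\<in>A. (ip g x + ip (\<theta> g) x) * (gauss m g * cnj (gauss m g))) =
    (\<Sum>g\<in>UNIV. ip g x * (gauss m g * cnj (gauss m g)))
      - (\<Sum>v\<in>U. ip v x * (gauss m v * cnj (gauss m v)))"
  unfolding sum_UNIV_split by (simp add: gauss_\<theta> distrib_right)

end

section \<open>Rational identities between the coefficients\<close>

context
  fixes a b :: complex
  assumes neq: "a - b \<noteq> 0" "a + b \<noteq> 0"
begin

text \<open>In the application \<open>x\<close>, \<open>y\<close>, \<open>z\<close> are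
  \<open>F\<^sub>1\<close>, \<open>F\<^sub>1\<^sub>2\<close>, \<open>F\<^sub>2\<close> at a common
  character: the left side is what remains of an indicator after its sums over the halves are
  evaluated, the right side is the weighted sum of squared Gauss pairs.\<close>

lemma coeff_LPi:
  "(a + b) / 2 / (2 * (a - b)) * (a ^ 4 * x + a\<^sup>2 * b\<^sup>2 * y + b ^ 4 * z)
   + (a - b) / 2 / (2 * (a + b)) * (a ^ 4 * x - a\<^sup>2 * b\<^sup>2 * y + b ^ 4 * z)
   + (b ^ 4 * z - a ^ 4 * x) / 2
   = a\<^sup>2 * b\<^sup>2 / ((a + b) * (a - b)) * (a\<^sup>2 * x + a * b * y + b\<^sup>2 * z)"
proof -
  define D where "D = 1 / ((a + b) * (a - b))"
  have D: "t / (2 * (a - b)) = (a + b) * t * D / 2" "t / (2 * (a + b)) = (a - b) * t * D / 2"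
      "t / ((a + b) * (a - b)) = t * D" for t
    using neq by (simp_all add: D_def)
  \<comment> \<open>With \<open>D\<close> as an opaque symbol for the common denominator, the one
    term without it is multiplied by \<open>1\<close> in this form, which leaves a polynomial
    identity.\<close>
  have one: "t = (a + b) * (a - b) * D * t" for t
    using neq by (simp add: D_def)
  show ?thesis
    unfolding D
    by (subst one[of "(b ^ 4 * z - a ^ 4 * x) / 2"]) (simp add: eval_nat_numeral field_simps)
qed

lemma coeff_LG:
  "a / (2 * (a - b)) * (a ^ 4 * x + a\<^sup>2 * b\<^sup>2 * y + b ^ 4 * z)
   + a / (2 * (a + b)) * (a ^ 4 * x - a\<^sup>2 * b\<^sup>2 * y + b ^ 4 * z) - a ^ 4 * x
   = a\<^sup>2 * b\<^sup>2 / ((a + b) * (a - b)) * (a\<^sup>2 * x + a * b * y + b\<^sup>2 * z)"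
proof -
  define D where "D = 1 / ((a + b) * (a - b))"
  have D: "t / (2 * (a - b)) = (a + b) * t * D / 2" "t / (2 * (a + b)) = (a - b) * t * D / 2"
      "t / ((a + b) * (a - b)) = t * D" for t
    using neq by (simp_all add: D_def)
  have one: "t = (a + b) * (a - b) * D * t" for t
    using neq by (simp add: D_def)
  show ?thesis
    unfolding D
    by (subst one[of "a ^ 4 * x"]) (simp add: eval_nat_numeral field_simps)
qed

text \<open>The identity \<open>coeff_LG\<close> with \<open>a\<close>, \<open>b\<close> and
  \<open>x\<close>, \<open>z\<close> exchanged; \<open>a - b\<close> changes sign under the
  exchange, which explains the different signs.\<close>

lemma coeff_LGamma:
  "b / (2 * (a - b)) * (a ^ 4 * x + a\<^sup>2 * b\<^sup>2 * y + b ^ 4 * z)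
   - b / (2 * (a + b)) * (a ^ 4 * x - a\<^sup>2 * b\<^sup>2 * y + b ^ 4 * z) + b ^ 4 * z
   = a\<^sup>2 * b\<^sup>2 / ((a + b) * (a - b)) * (a\<^sup>2 * x + a * b * y + b\<^sup>2 * z)"
proof -
  define D where "D = 1 / ((a + b) * (a - b))"
  have D: "t / (2 * (a - b)) = (a + b) * t * D / 2" "t / (2 * (a + b)) = (a - b) * t * D / 2"
      "t / ((a + b) * (a - b)) = t * D" for t
    using neq by (simp_all add: D_def)
  have one: "t = (a + b) * (a - b) * D * t" for t
    using neq by (simp add: D_def)
  show ?thesis
    unfolding D
    by (subst one[of "b ^ 4 * z"]) (simp add: eval_nat_numeral field_simps)
qed

end

section \<open>Two involutive metric groups with identified fixed points\<close>

locale involutive_pair =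
  G: involutive_group q\<^sub>1 \<theta>\<^sub>1 Gs + \<Gamma>: involutive_group q\<^sub>2 \<theta>\<^sub>2 \<Gamma>s
  for q\<^sub>1 :: "'g::{ab_group_add,finite} \<Rightarrow> complex" and \<theta>\<^sub>1 Gs
    and q\<^sub>2 :: "'h::{ab_group_add,finite} \<Rightarrow> complex" and \<theta>\<^sub>2 \<Gamma>s +
  fixes \<phi> :: "'g \<Rightarrow> 'h"
  assumes card_neq: "CARD('g) \<noteq> CARD('h)"
    and iso: "metric_iso_on (fixed_points \<theta>\<^sub>1) q\<^sub>1 (fixed_points \<theta>\<^sub>2) q\<^sub>2 \<phi>"
begin

abbreviation U :: "'g set" where "U \<equiv> fixed_points \<theta>\<^sub>1"
abbreviation J :: "('g, 'h) label set" where "J \<equiv> label_set \<theta>\<^sub>1 Gs \<Gamma>s"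
abbreviation S :: "('g, 'h) label \<Rightarrow> ('g, 'h) label \<Rightarrow> complex"
  where "S \<equiv> S_matrix q\<^sub>1 \<theta>\<^sub>1 q\<^sub>2 \<theta>\<^sub>2 \<phi>"
abbreviation T :: "('g, 'h) label \<Rightarrow> ('g, 'h) label \<Rightarrow> complex"
  where "T \<equiv> T_matrix q\<^sub>1 q\<^sub>2"
abbreviation bar :: "('g, 'h) label \<Rightarrow> ('g, 'h) label"
  where "bar \<equiv> label_bar \<theta>\<^sub>1 \<theta>\<^sub>2 Gs \<Gamma>s"

definition a :: complex where "a = 1 / of_real (sqrt (real CARD('g)))"
definition b :: complex where "b = 1 / of_real (sqrt (real CARD('h)))"

lemma a_sq: "a\<^sup>2 = 1 / of_nat CARD('g)" and b_sq: "b\<^sup>2 = 1 / of_nat CARD('h)"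
  by (simp_all add: a_def b_def power_divide flip: of_real_power)

lemma a_nonzero [simp]: "a \<noteq> 0" and b_nonzero [simp]: "b \<noteq> 0"
  by (simp_all add: a_def b_def)

lemma cnj_a [simp]: "cnj a = a" and cnj_b [simp]: "cnj b = b"
  by (simp_all add: a_def b_def)

lemma a_sq_neq: "a\<^sup>2 \<noteq> b\<^sup>2"
  using card_neq by (simp add: a_sq b_sq)

text \<open>Half of each of these is a first-row entry of the S-matrix, hence a denominator in the
  Verlinde formula; the unequal group orders make both nonzero.\<close>

lemma a_neq_b [simp]: "a - b \<noteq> 0" and a_plus_b [simp]: "a + b \<noteq> 0"
  using a_sq_neq by (auto simp: add_eq_0_iff2)

lemma card_coeff: "1 / (of_nat CARD('h) - of_nat CARD('g)) = a\<^sup>2 * b\<^sup>2 / (a\<^sup>2 - b\<^sup>2)"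
proof -
  have "complex_of_nat CARD('h) \<noteq> of_nat CARD('g)"
    using card_neq by simp
  then show ?thesis
    by (simp add: a_sq b_sq field_simps)
qed

lemma \<phi>_bij: "bij_betw \<phi> U (fixed_points \<theta>\<^sub>2)"
  and \<phi>_add: "u \<in> U \<Longrightarrow> v \<in> U \<Longrightarrow> \<phi> (u + v) = \<phi> u + \<phi> v"
  and q_\<phi>: "u \<in> U \<Longrightarrow> q\<^sub>2 (\<phi> u) = q\<^sub>1 u"
  using iso unfolding metric_iso_on_def by auto

lemma U_add: "u \<in> U \<Longrightarrow> v \<in> U \<Longrightarrow> u + v \<in> U"
  by (simp add: fixed_points_def G.\<theta>_add)

lemma U_minus: "u \<in> U \<Longrightarrow> - u \<in> U"
  by (simp add: fixed_points_def G.\<theta>_minus)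

lemma \<phi>_fixed: "u \<in> U \<Longrightarrow> \<phi> u \<in> fixed_points \<theta>\<^sub>2"
  using \<phi>_bij by (auto simp: bij_betw_def)

lemma \<phi>_zero [simp]: "\<phi> 0 = 0"
  using \<phi>_add[of 0 0] by simp

lemma \<phi>_minus: "u \<in> U \<Longrightarrow> \<phi> (- u) = - \<phi> u"
  using \<phi>_add[of u "- u"] by (simp add: U_minus add_eq_0_iff)

lemma ip_\<phi>: "u \<in> U \<Longrightarrow> v \<in> U \<Longrightarrow> bichar q\<^sub>2 (\<phi> u) (\<phi> v) = bichar q\<^sub>1 u v"
  using q_\<phi>[of "u + v"] by (simp add: bichar_def q_\<phi> \<phi>_add U_add)

lemma nat_mult_fixed: "u \<in> U \<Longrightarrow> nat_mult m u \<in> U"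
  by (induction m) (simp_all add: nat_mult_Suc U_add nat_mult_def[of 0])

lemma nat_mult_\<phi>: "u \<in> U \<Longrightarrow> nat_mult m (\<phi> u) = \<phi> (nat_mult m u)"
  by (induction m) (simp_all add: nat_mult_Suc \<phi>_add nat_mult_fixed nat_mult_def[of 0])

text \<open>By injectivity of \<phi> on \<open>U\<close>, the Kronecker deltas produced in the two
  groups agree on \<open>U\<close>.\<close>

lemma nat_mult_\<phi>_eq_0: "u \<in> U \<Longrightarrow> nat_mult m (\<phi> u) = 0 \<longleftrightarrow> nat_mult m u = 0"
  using \<phi>_bij nat_mult_fixed[of u m] G.zero_in_U \<phi>_zero
  by (metis nat_mult_\<phi> bij_betw_imp_inj_on inj_onD)

lemma sum_fixed_\<phi>: "(\<Sum>v\<in>fixed_points \<theta>\<^sub>2. f v) = (\<Sum>u\<in>U. f (\<phi> u))"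
  by (rule sum.reindex_bij_betw[OF \<phi>_bij, symmetric])

lemma sum_label_set:
  fixes f :: "('g, 'h) label \<Rightarrow> complex"
  shows "(\<Sum>w\<in>J. f w) = (\<Sum>u\<in>U. f (LZero u)) + (\<Sum>u\<in>U. f (LPi u)) + (\<Sum>g\<in>Gs. f (LG g))
    + (\<Sum>\<gamma>\<in>\<Gamma>s. f (LGamma \<gamma>))"
proof -
  have "(\<Sum>w\<in>J. f w) = sum f (LZero ` U) + sum f (LPi ` U) + sum f (LG ` Gs) + sum f (LGamma ` \<Gamma>s)"
    unfolding label_set_def
    by (subst sum.union_disjoint; (subst sum.union_disjoint)?; (subst sum.union_disjoint)?) auto
  also have "\<dots> = (\<Sum>u\<in>U. f (LZero u)) + (\<Sum>u\<in>U. f (LPi u)) + (\<Sum>g\<in>Gs. f (LG g))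
    + (\<Sum>\<gamma>\<in>\<Gamma>s. f (LGamma \<gamma>))"
    by (simp add: sum.reindex inj_on_def)
  finally show ?thesis .
qed

section \<open>The S-matrix and conjugation of labels\<close>

lemma S_simps:
  "S (LZero u) (LZero u') = (a - b) / 2 * cnj (bichar q\<^sub>1 u u')"
  "S (LZero u) (LPi u') = (a + b) / 2 * cnj (bichar q\<^sub>1 u u')"
  "S (LZero u) (LG g') = a * cnj (bichar q\<^sub>1 u g')"
  "S (LZero u) (LGamma \<gamma>') = b * cnj (bichar q\<^sub>2 (\<phi> u) \<gamma>')"
  "S (LPi u) (LZero u') = (a + b) / 2 * cnj (bichar q\<^sub>1 u u')"
  "S (LPi u) (LPi u') = (a - b) / 2 * cnj (bichar q\<^sub>1 u u')"
  "S (LPi u) (LG g') = a * cnj (bichar q\<^sub>1 u g')"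
  "S (LPi u) (LGamma \<gamma>') = - b * cnj (bichar q\<^sub>2 (\<phi> u) \<gamma>')"
  "S (LG g) (LZero u') = a * cnj (bichar q\<^sub>1 g u')"
  "S (LG g) (LPi u') = a * cnj (bichar q\<^sub>1 g u')"
  "S (LG g) (LG g') = a * (cnj (bichar q\<^sub>1 g g') + cnj (bichar q\<^sub>1 (\<theta>\<^sub>1 g) g'))"
  "S (LG g) (LGamma \<gamma>') = 0"
  "S (LGamma \<gamma>) (LZero u') = b * cnj (bichar q\<^sub>2 \<gamma> (\<phi> u'))"
  "S (LGamma \<gamma>) (LPi u') = - b * cnj (bichar q\<^sub>2 \<gamma> (\<phi> u'))"
  "S (LGamma \<gamma>) (LG g') = 0"
  "S (LGamma \<gamma>) (LGamma \<gamma>') = - b * (cnj (bichar q\<^sub>2 \<gamma> \<gamma>') + cnj (bichar q\<^sub>2 (\<theta>\<^sub>2 \<gamma>) \<gamma>'))"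
  by (simp_all add: S_matrix_def a_def b_def Let_def)

lemma S_zero:
  "S (LZero 0) (LZero u) = (a - b) / 2" "S (LZero 0) (LPi u) = (a + b) / 2"
  "S (LZero 0) (LG g) = a" "S (LZero 0) (LGamma \<gamma>) = b"
  by (simp_all add: S_simps)

text \<open>A column depends only on the orbit of its label: in the rows of \<open>U\<close> the
  involution is invisible, and in the rows \<open>LG\<close> it swaps the two summands.\<close>

lemma S_LG_\<theta>: "w \<in> J \<Longrightarrow> S w (LG (\<theta>\<^sub>1 g)) = S w (LG g)"
  by (auto simp: label_set_def S_simps G.ip_\<theta>_fixed_left G.ip_\<theta>_right add.commute)

lemma S_LGamma_\<theta>: "w \<in> J \<Longrightarrow> S w (LGamma (\<theta>\<^sub>2 \<gamma>)) = S w (LGamma \<gamma>)"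
  by (auto simp: label_set_def S_simps \<Gamma>.ip_\<theta>_fixed_left \<phi>_fixed \<Gamma>.ip_\<theta>_right add.commute)

text \<open>Negation in the second argument conjugates the pairing. The further involution that
  \<open>bar\<close> may apply to return to the chosen half leaves the column unchanged.\<close>

lemma S_bar:
  assumes "w \<in> J"
  shows "u \<in> U \<Longrightarrow> S w (bar (LZero u)) = cnj (S w (LZero u))"
    and "u \<in> U \<Longrightarrow> S w (bar (LPi u)) = cnj (S w (LPi u))"
    and "S w (bar (LG g)) = cnj (S w (LG g))"
    and "S w (bar (LGamma \<gamma>)) = cnj (S w (LGamma \<gamma>))"
proof -
  show "u \<in> U \<Longrightarrow> S w (bar (LZero u)) = cnj (S w (LZero u))"
    and "u \<in> U \<Longrightarrow> S w (bar (LPi u)) = cnj (S w (LPi u))"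
    by (cases w; simp add: S_simps G.ip_minus_right \<Gamma>.ip_minus_right \<phi>_minus)+
  have "S w (LG (- g)) = cnj (S w (LG g))" "S w (LGamma (- \<gamma>)) = cnj (S w (LGamma \<gamma>))"
    by (cases w; simp add: S_simps G.ip_minus_right \<Gamma>.ip_minus_right)+
  then show "S w (bar (LG g)) = cnj (S w (LG g))" "S w (bar (LGamma \<gamma>)) = cnj (S w (LGamma \<gamma>))"
    by (simp_all add: S_LG_\<theta>[OF assms] S_LGamma_\<theta>[OF assms])
qed

section \<open>Separating the Verlinde sum into rows\<close>

definition row :: "('g, 'h) label \<Rightarrow> (('g, 'h) label \<Rightarrow> complex) \<Rightarrow> complex" where
  "row w r = (\<Sum>y\<in>J. S w y * S (LZero 0) y * r y)"

text \<open>The weights are invariant and agree on \<open>U\<close>, so the sums over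
  \<open>Gs\<close> and \<open>\<Gamma>s\<close> complete to sums over both groups once the two
  copies of \<open>U\<close> supply the missing terms.\<close>

lemma row_fourier:
  assumes r\<^sub>1: "\<And>g. r\<^sub>1 (\<theta>\<^sub>1 g) = r\<^sub>1 g" and r\<^sub>2: "\<And>\<gamma>. r\<^sub>2 (\<theta>\<^sub>2 \<gamma>) = r\<^sub>2 \<gamma>"
    and r: "\<And>u. u \<in> U \<Longrightarrow> r\<^sub>2 (\<phi> u) = r\<^sub>1 u"
  defines "R \<equiv> case_label r\<^sub>1 r\<^sub>1 r\<^sub>1 r\<^sub>2"
  shows "u \<in> U \<Longrightarrow> row (LZero u) R = (a\<^sup>2 * G.fourier r\<^sub>1 u + b\<^sup>2 * \<Gamma>.fourier r\<^sub>2 (\<phi> u)) / 2"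
    and "u \<in> U \<Longrightarrow> row (LPi u) R = (a\<^sup>2 * G.fourier r\<^sub>1 u - b\<^sup>2 * \<Gamma>.fourier r\<^sub>2 (\<phi> u)) / 2"
    and "row (LG g) R = a\<^sup>2 * G.fourier r\<^sub>1 g"
    and "row (LGamma \<gamma>) R = - b\<^sup>2 * \<Gamma>.fourier r\<^sub>2 \<gamma>"
proof -
  define s where "s u = (\<Sum>v\<in>U. cnj (bichar q\<^sub>1 u v) * r\<^sub>1 v)" for u
  define s\<^sub>1 where "s\<^sub>1 u = (\<Sum>g\<in>Gs. cnj (bichar q\<^sub>1 u g) * r\<^sub>1 g)" for u
  define s\<^sub>2 where "s\<^sub>2 u = (\<Sum>\<gamma>\<in>\<Gamma>s. cnj (bichar q\<^sub>2 u \<gamma>) * r\<^sub>2 \<gamma>)" for u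
  {
    assume u: "u \<in> U"
    have 1: "G.fourier r\<^sub>1 u = s u + 2 * s\<^sub>1 u"
      by (simp add: G.fourier_split s_def s\<^sub>1_def r\<^sub>1 G.ip_\<theta>_fixed u mult.commute flip: sum_distrib_left)
    have 2: "\<Gamma>.fourier r\<^sub>2 (\<phi> u) = s u + 2 * s\<^sub>2 (\<phi> u)"
      by (simp add: \<Gamma>.fourier_split s_def s\<^sub>2_def r\<^sub>2 \<Gamma>.ip_\<theta>_fixed u \<phi>_fixed
          sum_fixed_\<phi> ip_\<phi> r mult.commute flip: sum_distrib_left)
    have "row (LZero u) R = ((a - b) / 2)\<^sup>2 * s u + ((a + b) / 2)\<^sup>2 * s u + a\<^sup>2 * s\<^sub>1 u + b\<^sup>2 * s\<^sub>2 (\<phi> u)"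
      unfolding row_def sum_label_set s_def s\<^sub>1_def s\<^sub>2_def sum_distrib_left
      by (simp add: S_simps R_def power2_eq_square mult_ac)
    \<comment> \<open>The two copies of \<open>U\<close> contribute \<open>((a - b) / 2)\<^sup>2 +
      ((a + b) / 2)\<^sup>2 = (a\<^sup>2 + b\<^sup>2) / 2\<close>, exactly the share of
      \<open>U\<close> in each full sum.\<close>
    also have "\<dots> = (a\<^sup>2 * (s u + 2 * s\<^sub>1 u) + b\<^sup>2 * (s u + 2 * s\<^sub>2 (\<phi> u))) / 2"
      by (simp add: field_simps power2_eq_square)
    finally show "row (LZero u) R = (a\<^sup>2 * G.fourier r\<^sub>1 u + b\<^sup>2 * \<Gamma>.fourier r\<^sub>2 (\<phi> u)) / 2"
      unfolding 1 2 .
    have "row (LPi u) R = (a + b) / 2 * ((a - b) / 2) * s u + (a + b) / 2 * ((a - b) / 2) * s u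
        + a\<^sup>2 * s\<^sub>1 u - b\<^sup>2 * s\<^sub>2 (\<phi> u)"
      unfolding row_def sum_label_set s_def s\<^sub>1_def s\<^sub>2_def sum_distrib_left
      by (simp add: S_simps R_def power2_eq_square mult_ac sum_negf)
    also have "\<dots> = (a\<^sup>2 * (s u + 2 * s\<^sub>1 u) - b\<^sup>2 * (s u + 2 * s\<^sub>2 (\<phi> u))) / 2"
      by (simp add: field_simps power2_eq_square)
    finally show "row (LPi u) R = (a\<^sup>2 * G.fourier r\<^sub>1 u - b\<^sup>2 * \<Gamma>.fourier r\<^sub>2 (\<phi> u)) / 2"
      unfolding 1 2 .
  }
  have "G.fourier r\<^sub>1 g = s g + (\<Sum>g'\<in>Gs. cnj (bichar q\<^sub>1 g g') * r\<^sub>1 g' + cnj (bichar q\<^sub>1 (\<theta>\<^sub>1 g) g') * r\<^sub>1 g')"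
    by (simp add: G.fourier_split s_def r\<^sub>1 G.ip_\<theta>_right)
  moreover have "row (LG g) R = a * ((a - b) / 2) * s g + a * ((a + b) / 2) * s g
     + a\<^sup>2 * (\<Sum>g'\<in>Gs. cnj (bichar q\<^sub>1 g g') * r\<^sub>1 g' + cnj (bichar q\<^sub>1 (\<theta>\<^sub>1 g) g') * r\<^sub>1 g')"
    unfolding row_def sum_label_set s_def sum_distrib_left
    by (simp add: S_simps R_def power2_eq_square algebra_simps)
  ultimately show "row (LG g) R = a\<^sup>2 * G.fourier r\<^sub>1 g"
    by (simp add: field_simps power2_eq_square)
  define s' where "s' = (\<Sum>v\<in>U. cnj (bichar q\<^sub>2 \<gamma> (\<phi> v)) * r\<^sub>1 v)"
  have "\<Gamma>.fourier r\<^sub>2 \<gamma> = s' + (\<Sum>\<gamma>'\<in>\<Gamma>s. cnj (bichar q\<^sub>2 \<gamma> \<gamma>') * r\<^sub>2 \<gamma>' + cnj (bichar q\<^sub>2 (\<theta>\<^sub>2 \<gamma>) \<gamma>') * r\<^sub>2 \<gamma>')"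
    by (simp add: \<Gamma>.fourier_split s'_def r\<^sub>2 \<Gamma>.ip_\<theta>_right sum_fixed_\<phi> r)
  \<comment> \<open>The mixed terms \<open>a * b\<close> cancel between the copies of
    \<open>U\<close>, and the coefficient of \<open>s'\<close> becomes \<open>- b\<^sup>2\<close>,
    matching that of the sum over \<open>\<Gamma>s\<close>.\<close>
  moreover have "row (LGamma \<gamma>) R = b * ((a - b) / 2) * s' - b * ((a + b) / 2) * s'
     - b\<^sup>2 * (\<Sum>\<gamma>'\<in>\<Gamma>s. cnj (bichar q\<^sub>2 \<gamma> \<gamma>') * r\<^sub>2 \<gamma>' + cnj (bichar q\<^sub>2 (\<theta>\<^sub>2 \<gamma>) \<gamma>') * r\<^sub>2 \<gamma>')"
    unfolding row_def sum_label_set s'_def sum_distrib_left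
    by (simp add: S_simps R_def power2_eq_square algebra_simps sum_negf sum.distrib sum_subtractf)
  ultimately show "row (LGamma \<gamma>) R = - b\<^sup>2 * \<Gamma>.fourier r\<^sub>2 \<gamma>"
    by (simp add: field_simps power2_eq_square)
qed

text \<open>With the Verlinde index \<open>w\<close> outermost, the summand is a product of a factor
  in \<open>x\<close> and a factor in \<open>y\<close>, so the double sum splits.\<close>

lemma nu_eq_sum_rows:
  "nu q\<^sub>1 \<theta>\<^sub>1 q\<^sub>2 \<theta>\<^sub>2 \<phi> Gs \<Gamma>s m z =
     (\<Sum>w\<in>J. S w (bar z) / S (LZero 0) w *
        (row w (\<lambda>y. T y y ^ m) * row w (\<lambda>x. inverse (T x x) ^ m)))"
proof -
  let ?f = "\<lambda>w x y. S w (bar z) / S (LZero 0) w *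
      ((S w y * S (LZero 0) y * T y y ^ m) * (S w x * S (LZero 0) x * inverse (T x x) ^ m))"
  have "nu q\<^sub>1 \<theta>\<^sub>1 q\<^sub>2 \<theta>\<^sub>2 \<phi> Gs \<Gamma>s m z = (\<Sum>x\<in>J. \<Sum>y\<in>J. \<Sum>w\<in>J. ?f w x y)"
    unfolding nu_def fusion_def fusion3_def Let_def sum_distrib_right divide_inverse
      power_mult_distrib
    by (simp only: mult_ac)
  also have "\<dots> = (\<Sum>x\<in>J. \<Sum>w\<in>J. \<Sum>y\<in>J. ?f w x y)"
    by (intro sum.cong refl sum.swap)
  also have "\<dots> = (\<Sum>w\<in>J. \<Sum>x\<in>J. \<Sum>y\<in>J. ?f w x y)"
    by (rule sum.swap)
  also have "\<dots> = (\<Sum>w\<in>J. \<Sum>y\<in>J. \<Sum>x\<in>J. ?f w x y)"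
    by (intro sum.cong refl sum.swap)
  also have "\<dots> = (\<Sum>w\<in>J. S w (bar z) / S (LZero 0) w *
        (row w (\<lambda>y. T y y ^ m) * row w (\<lambda>x. inverse (T x x) ^ m)))"
    unfolding row_def by (simp only: sum_product) (simp only: sum_distrib_left)
  finally show ?thesis .
qed

abbreviation sq :: "complex \<Rightarrow> complex" where "sq x \<equiv> x * cnj x"

text \<open>The weights have modulus 1 and \<open>a\<close>, \<open>b\<close> are real, so inverting
  the weights conjugates the row sum and each product is a squared modulus.\<close>

lemma row_T:
  shows "u \<in> U \<Longrightarrow> row (LZero u) (\<lambda>y. T y y ^ m) * row (LZero u) (\<lambda>x. inverse (T x x) ^ m)
      = sq (a\<^sup>2 * G.gauss m u + b\<^sup>2 * \<Gamma>.gauss m (\<phi> u)) / 4"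
    and "u \<in> U \<Longrightarrow> row (LPi u) (\<lambda>y. T y y ^ m) * row (LPi u) (\<lambda>x. inverse (T x x) ^ m)
      = sq (a\<^sup>2 * G.gauss m u - b\<^sup>2 * \<Gamma>.gauss m (\<phi> u)) / 4"
    and "row (LG g) (\<lambda>y. T y y ^ m) * row (LG g) (\<lambda>x. inverse (T x x) ^ m)
      = a ^ 4 * sq (G.gauss m g)"
    and "row (LGamma \<gamma>) (\<lambda>y. T y y ^ m) * row (LGamma \<gamma>) (\<lambda>x. inverse (T x x) ^ m)
      = b ^ 4 * sq (\<Gamma>.gauss m \<gamma>)"
proof -
  have T: "(\<lambda>y. T y y ^ m) =
      case_label (\<lambda>g. q\<^sub>1 g ^ m) (\<lambda>g. q\<^sub>1 g ^ m) (\<lambda>g. q\<^sub>1 g ^ m) (\<lambda>\<gamma>. q\<^sub>2 \<gamma> ^ m)"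
    by (auto simp: fun_eq_iff T_matrix_def split: label.split)
  have T': "(\<lambda>y. inverse (T y y) ^ m) =
      case_label (\<lambda>g. inverse (q\<^sub>1 g) ^ m) (\<lambda>g. inverse (q\<^sub>1 g) ^ m) (\<lambda>g. inverse (q\<^sub>1 g) ^ m)
        (\<lambda>\<gamma>. inverse (q\<^sub>2 \<gamma>) ^ m)"
    by (auto simp: fun_eq_iff T_matrix_def split: label.split)
  note rows = row_fourier[of "\<lambda>g. q\<^sub>1 g ^ m" "\<lambda>\<gamma>. q\<^sub>2 \<gamma> ^ m"]
    row_fourier[of "\<lambda>g. inverse (q\<^sub>1 g) ^ m" "\<lambda>\<gamma>. inverse (q\<^sub>2 \<gamma>) ^ m"]
  show "u \<in> U \<Longrightarrow> row (LZero u) (\<lambda>y. T y y ^ m) * row (LZero u) (\<lambda>x. inverse (T x x) ^ m)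
      = sq (a\<^sup>2 * G.gauss m u + b\<^sup>2 * \<Gamma>.gauss m (\<phi> u)) / 4"
    and "u \<in> U \<Longrightarrow> row (LPi u) (\<lambda>y. T y y ^ m) * row (LPi u) (\<lambda>x. inverse (T x x) ^ m)
      = sq (a\<^sup>2 * G.gauss m u - b\<^sup>2 * \<Gamma>.gauss m (\<phi> u)) / 4"
    and "row (LG g) (\<lambda>y. T y y ^ m) * row (LG g) (\<lambda>x. inverse (T x x) ^ m)
      = a ^ 4 * sq (G.gauss m g)"
    and "row (LGamma \<gamma>) (\<lambda>y. T y y ^ m) * row (LGamma \<gamma>) (\<lambda>x. inverse (T x x) ^ m)
      = b ^ 4 * sq (\<Gamma>.gauss m \<gamma>)"
    unfolding T T'
    by (simp_all add: rows q_\<phi> G.fourier_q \<Gamma>.fourier_q G.fourier_q_inverse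
        \<Gamma>.fourier_q_inverse power4_eq_xxxx power2_eq_square)
qed

text \<open>Dividing the squared rows by the first-row entries \<open>(a - b) / 2\<close>,
  \<open>(a + b) / 2\<close>, \<open>a\<close>, \<open>b\<close> turns the factors
  \<open>1 / 4\<close>, \<open>a ^ 4\<close>, \<open>b ^ 4\<close> into the coefficients
  shown.\<close>

lemma nu_eq:
  assumes K: "\<forall>w\<in>J. S w (bar z) = cnj (S w z)"
  shows "nu q\<^sub>1 \<theta>\<^sub>1 q\<^sub>2 \<theta>\<^sub>2 \<phi> Gs \<Gamma>s m z =
     (\<Sum>u\<in>U. cnj (S (LZero u) z) / (2 * (a - b)) * sq (a\<^sup>2 * G.gauss m u + b\<^sup>2 * \<Gamma>.gauss m (\<phi> u)))
   + (\<Sum>u\<in>U. cnj (S (LPi u) z) / (2 * (a + b)) * sq (a\<^sup>2 * G.gauss m u - b\<^sup>2 * \<Gamma>.gauss m (\<phi> u)))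
   + (\<Sum>g\<in>Gs. cnj (S (LG g) z) * a ^ 3 * sq (G.gauss m g))
   + (\<Sum>\<gamma>\<in>\<Gamma>s. cnj (S (LGamma \<gamma>) z) * b ^ 3 * sq (\<Gamma>.gauss m \<gamma>))"
proof -
  have *: "x / ((a - b) / 2) * (y / 4) = x / (2 * (a - b)) * y"
    "x / ((a + b) / 2) * (y / 4) = x / (2 * (a + b)) * y"
    "x / a * (a ^ 4 * y) = x * a ^ 3 * y" "x / b * (b ^ 4 * y) = x * b ^ 3 * y" for x y
    by (simp_all add: field_simps eval_nat_numeral)
  have "LZero u \<in> J" "LPi u \<in> J" if "u \<in> U" for u
    using that by (auto simp: label_set_def)
  moreover have "LG g \<in> J" if "g \<in> Gs" for g
    using that by (auto simp: label_set_def)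
  moreover have "LGamma \<gamma> \<in> J" if "\<gamma> \<in> \<Gamma>s" for \<gamma>
    using that by (auto simp: label_set_def)
  ultimately show ?thesis
    unfolding nu_eq_sum_rows sum_label_set
    by (intro arg_cong2[where f = "(+)"] sum.cong refl;
      simp only: row_T K[rule_format] S_zero *)
qed

section \<open>Quadratic sums of Gauss sums\<close>

lemma sum_ip_gauss_sq_G:
  "a ^ 4 * (\<Sum>g\<in>UNIV. bichar q\<^sub>1 g x * sq (G.gauss m g)) = of_bool (nat_mult m x = 0) * q\<^sub>1 x ^ m"
proof -
  have "a ^ 4 * (of_nat CARD('g))\<^sup>2 = 1"
    using a_sq by (simp add: power4_eq_xxxx power2_eq_square field_simps)
  then show ?thesis
    unfolding G.sum_ip_gauss_sq by (simp add: mult.assoc[symmetric])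
qed

lemma sum_ip_gauss_sq_\<Gamma>:
  "b ^ 4 * (\<Sum>\<gamma>\<in>UNIV. bichar q\<^sub>2 \<gamma> x * sq (\<Gamma>.gauss m \<gamma>)) = of_bool (nat_mult m x = 0) * q\<^sub>2 x ^ m"
proof -
  have "b ^ 4 * (of_nat CARD('h))\<^sup>2 = 1"
    using b_sq by (simp add: power4_eq_xxxx power2_eq_square field_simps)
  then show ?thesis
    unfolding \<Gamma>.sum_ip_gauss_sq by (simp add: mult.assoc[symmetric])
qed

text \<open>The sums \<open>F\<^sub>1\<close>, \<open>F\<^sub>2\<close>,
  \<open>F\<^sub>1\<^sub>2\<close> separate the two square terms and the cross term of a squared
  combination of Gauss sums over \<open>U\<close>; \<open>e\<close> will be a character.\<close>

definition F\<^sub>1 :: "nat \<Rightarrow> ('g \<Rightarrow> complex) \<Rightarrow> complex" where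
  "F\<^sub>1 m e = (\<Sum>v\<in>U. e v * sq (G.gauss m v))"

definition F\<^sub>2 :: "nat \<Rightarrow> ('g \<Rightarrow> complex) \<Rightarrow> complex" where
  "F\<^sub>2 m e = (\<Sum>v\<in>U. e v * sq (\<Gamma>.gauss m (\<phi> v)))"

definition F\<^sub>1\<^sub>2 :: "nat \<Rightarrow> ('g \<Rightarrow> complex) \<Rightarrow> complex" where
  "F\<^sub>1\<^sub>2 m e = (\<Sum>v\<in>U. e v * (G.gauss m v * cnj (\<Gamma>.gauss m (\<phi> v))
     + \<Gamma>.gauss m (\<phi> v) * cnj (G.gauss m v)))"

text \<open>Used with coefficients \<open>a\<^sup>2\<close> and \<open>b\<^sup>2\<close> or
  \<open>- b\<^sup>2\<close> for the rows over \<open>U\<close>, and with \<open>a\<close> and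
  \<open>b\<close> for the Gauss pair.\<close>

lemma sum_sq_expand:
  assumes "cnj s = s" "cnj t = t"
  shows "(\<Sum>v\<in>U. e v * sq (s * G.gauss m v + t * \<Gamma>.gauss m (\<phi> v))) =
    s\<^sup>2 * F\<^sub>1 m e + s * t * F\<^sub>1\<^sub>2 m e + t\<^sup>2 * F\<^sub>2 m e"
  unfolding F\<^sub>1_def F\<^sub>2_def F\<^sub>1\<^sub>2_def sum_distrib_left sum.distrib[symmetric]
  by (intro sum.cong refl) (simp add: assms power2_eq_square algebra_simps)

lemma gauss_pair_sum:
  "1 / (of_nat CARD('h) - of_nat CARD('g)) *
      (\<Sum>v\<in>U. e v * of_real ((cmod (gauss_pair q\<^sub>1 q\<^sub>2 \<phi> v (int m)))\<^sup>2)) =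
    a\<^sup>2 * b\<^sup>2 / ((a + b) * (a - b)) * (a\<^sup>2 * F\<^sub>1 m e + a * b * F\<^sub>1\<^sub>2 m e + b\<^sup>2 * F\<^sub>2 m e)"
proof -
  have "gauss_pair q\<^sub>1 q\<^sub>2 \<phi> v (int m) = a * G.gauss m v + b * \<Gamma>.gauss m (\<phi> v)" for v
    by (simp add: gauss_pair_def a_def b_def G.gauss_def \<Gamma>.gauss_def)
  moreover have "a\<^sup>2 - b\<^sup>2 = (a + b) * (a - b)"
    by (simp add: power2_eq_square algebra_simps)
  ultimately show ?thesis
    unfolding card_coeff complex_norm_square by (simp only: sum_sq_expand cnj_a cnj_b)
qed

text \<open>All four kinds of labels have columns of this shape: real multiples of one conjugated
  character on both copies of \<open>U\<close>, and of conjugated weights \<open>f\<close>,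
  \<open>h\<close> on the halves. Only the constants and weights differ.\<close>

lemma nu_column:
  assumes K: "\<forall>w\<in>J. S w (bar z) = cnj (S w z)"
    and real: "cnj c\<^sub>1 = c\<^sub>1" "cnj c\<^sub>2 = c\<^sub>2" "cnj c\<^sub>3 = c\<^sub>3" "cnj c\<^sub>4 = c\<^sub>4"
    and S: "\<And>v. v \<in> U \<Longrightarrow> S (LZero v) z = c\<^sub>1 * cnj (e v)"
      "\<And>v. v \<in> U \<Longrightarrow> S (LPi v) z = c\<^sub>2 * cnj (e v)"
      "\<And>g. S (LG g) z = c\<^sub>3 * cnj (f g)" "\<And>\<gamma>. S (LGamma \<gamma>) z = c\<^sub>4 * cnj (h \<gamma>)"
  shows "nu q\<^sub>1 \<theta>\<^sub>1 q\<^sub>2 \<theta>\<^sub>2 \<phi> Gs \<Gamma>s m z =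
     c\<^sub>1 / (2 * (a - b)) * (a ^ 4 * F\<^sub>1 m e + a\<^sup>2 * b\<^sup>2 * F\<^sub>1\<^sub>2 m e + b ^ 4 * F\<^sub>2 m e)
   + c\<^sub>2 / (2 * (a + b)) * (a ^ 4 * F\<^sub>1 m e - a\<^sup>2 * b\<^sup>2 * F\<^sub>1\<^sub>2 m e + b ^ 4 * F\<^sub>2 m e)
   + c\<^sub>3 * a ^ 3 * (\<Sum>g\<in>Gs. f g * sq (G.gauss m g))
   + c\<^sub>4 * b ^ 3 * (\<Sum>\<gamma>\<in>\<Gamma>s. h \<gamma> * sq (\<Gamma>.gauss m \<gamma>))"
proof -
  have 1: "a ^ 4 * F\<^sub>1 m e + a\<^sup>2 * b\<^sup>2 * F\<^sub>1\<^sub>2 m e + b ^ 4 * F\<^sub>2 m e =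
      (\<Sum>v\<in>U. e v * sq (a\<^sup>2 * G.gauss m v + b\<^sup>2 * \<Gamma>.gauss m (\<phi> v)))"
    by (subst sum_sq_expand) simp_all
  have 2: "a ^ 4 * F\<^sub>1 m e - a\<^sup>2 * b\<^sup>2 * F\<^sub>1\<^sub>2 m e + b ^ 4 * F\<^sub>2 m e =
      (\<Sum>v\<in>U. e v * sq (a\<^sup>2 * G.gauss m v - b\<^sup>2 * \<Gamma>.gauss m (\<phi> v)))"
    using sum_sq_expand[of "a\<^sup>2" "- b\<^sup>2" e m] by simp
  show ?thesis
    unfolding nu_eq[OF K] 1 2 sum_distrib_left
    by (intro arg_cong2[where f = "(+)"] sum.cong refl)
      (simp_all only: S complex_cnj_mult complex_cnj_cnj real times_divide_eq_left times_divide_eq_right mult_ac)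
qed

section \<open>The four indicator formulas\<close>

lemma nu_LZero_LPi:
  assumes u: "u \<in> U"
  shows "nu q\<^sub>1 \<theta>\<^sub>1 q\<^sub>2 \<theta>\<^sub>2 \<phi> Gs \<Gamma>s m (LZero u) = of_bool (nat_mult m u = 0) * q\<^sub>1 u ^ m" (is "_ = ?P")
    and "nu q\<^sub>1 \<theta>\<^sub>1 q\<^sub>2 \<theta>\<^sub>2 \<phi> Gs \<Gamma>s m (LPi u) =
      1 / (of_nat CARD('h) - of_nat CARD('g)) *
        (\<Sum>v\<in>U. bichar q\<^sub>1 u v * of_real ((cmod (gauss_pair q\<^sub>1 q\<^sub>2 \<phi> v (int m)))\<^sup>2))"
proof -
  let ?e = "\<lambda>v. bichar q\<^sub>1 v u"
  have "(\<Sum>g\<in>Gs. ?e g * sq (G.gauss m g)) = ((\<Sum>g\<in>UNIV. ?e g * sq (G.gauss m g)) - F\<^sub>1 m ?e) / 2"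
    unfolding F\<^sub>1_def by (rule G.sum_half_fixed[OF u])
  then have G: "a ^ 4 * (\<Sum>g\<in>Gs. ?e g * sq (G.gauss m g)) = (?P - a ^ 4 * F\<^sub>1 m ?e) / 2"
    by (simp only: right_diff_distrib times_divide_eq_right sum_ip_gauss_sq_G)
  have "(\<Sum>\<gamma>\<in>\<Gamma>s. bichar q\<^sub>2 \<gamma> (\<phi> u) * sq (\<Gamma>.gauss m \<gamma>)) =
      ((\<Sum>\<gamma>\<in>UNIV. bichar q\<^sub>2 \<gamma> (\<phi> u) * sq (\<Gamma>.gauss m \<gamma>)) - F\<^sub>2 m ?e) / 2"
    unfolding \<Gamma>.sum_half_fixed[OF \<phi>_fixed[OF u]] F\<^sub>2_def
    by (simp add: sum_fixed_\<phi> ip_\<phi> u)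
  then have \<Gamma>: "b ^ 4 * (\<Sum>\<gamma>\<in>\<Gamma>s. bichar q\<^sub>2 \<gamma> (\<phi> u) * sq (\<Gamma>.gauss m \<gamma>)) = (?P - b ^ 4 * F\<^sub>2 m ?e) / 2"
    by (simp only: right_diff_distrib times_divide_eq_right sum_ip_gauss_sq_\<Gamma>
        nat_mult_\<phi>_eq_0[OF u] q_\<phi>[OF u])
  have quarter: "p / 2 / (2 * p) = 1 / 4" if "p \<noteq> 0" for p :: complex
    using that by simp
  have 4: "a * a ^ 3 = a ^ 4" "b * b ^ 3 = b ^ 4"
    by (simp_all add: eval_nat_numeral)
  have "nu q\<^sub>1 \<theta>\<^sub>1 q\<^sub>2 \<theta>\<^sub>2 \<phi> Gs \<Gamma>s m (LZero u) =
     (a - b) / 2 / (2 * (a - b)) * (a ^ 4 * F\<^sub>1 m ?e + a\<^sup>2 * b\<^sup>2 * F\<^sub>1\<^sub>2 m ?e + b ^ 4 * F\<^sub>2 m ?e)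
   + (a + b) / 2 / (2 * (a + b)) * (a ^ 4 * F\<^sub>1 m ?e - a\<^sup>2 * b\<^sup>2 * F\<^sub>1\<^sub>2 m ?e + b ^ 4 * F\<^sub>2 m ?e)
   + a * a ^ 3 * (\<Sum>g\<in>Gs. ?e g * sq (G.gauss m g))
   + b * b ^ 3 * (\<Sum>\<gamma>\<in>\<Gamma>s. bichar q\<^sub>2 \<gamma> (\<phi> u) * sq (\<Gamma>.gauss m \<gamma>))"
    by (rule nu_column) (simp_all add: S_bar u S_simps del: label_bar.simps)
  \<comment> \<open>The column entries cancel the denominators, so the cross terms have opposite
    coefficients. The \<open>F\<^sub>1\<close> and \<open>F\<^sub>2\<close> terms cancel against
    those of the half sums, leaving \<open>?P / 2\<close> from each group.\<close>
  also have "\<dots> = (a ^ 4 * F\<^sub>1 m ?e + a\<^sup>2 * b\<^sup>2 * F\<^sub>1\<^sub>2 m ?e + b ^ 4 * F\<^sub>2 m ?e) / 4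
     + (a ^ 4 * F\<^sub>1 m ?e - a\<^sup>2 * b\<^sup>2 * F\<^sub>1\<^sub>2 m ?e + b ^ 4 * F\<^sub>2 m ?e) / 4
     + (?P - a ^ 4 * F\<^sub>1 m ?e) / 2 + (?P - b ^ 4 * F\<^sub>2 m ?e) / 2"
    unfolding 4 G \<Gamma> quarter[OF a_neq_b] quarter[OF a_plus_b] by simp
  also have "\<dots> = ?P"
    by (simp add: field_simps)
  finally show "nu q\<^sub>1 \<theta>\<^sub>1 q\<^sub>2 \<theta>\<^sub>2 \<phi> Gs \<Gamma>s m (LZero u) = ?P" .
  have "nu q\<^sub>1 \<theta>\<^sub>1 q\<^sub>2 \<theta>\<^sub>2 \<phi> Gs \<Gamma>s m (LPi u) =
     (a + b) / 2 / (2 * (a - b)) * (a ^ 4 * F\<^sub>1 m ?e + a\<^sup>2 * b\<^sup>2 * F\<^sub>1\<^sub>2 m ?e + b ^ 4 * F\<^sub>2 m ?e)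
   + (a - b) / 2 / (2 * (a + b)) * (a ^ 4 * F\<^sub>1 m ?e - a\<^sup>2 * b\<^sup>2 * F\<^sub>1\<^sub>2 m ?e + b ^ 4 * F\<^sub>2 m ?e)
   + a * a ^ 3 * (\<Sum>g\<in>Gs. ?e g * sq (G.gauss m g))
   + (- b) * b ^ 3 * (\<Sum>\<gamma>\<in>\<Gamma>s. bichar q\<^sub>2 \<gamma> (\<phi> u) * sq (\<Gamma>.gauss m \<gamma>))"
    by (rule nu_column) (simp_all add: S_bar u S_simps del: label_bar.simps)
  \<comment> \<open>For \<pi> the sum over \<open>\<Gamma>s\<close> enters with the opposite sign,
    so the two copies of \<open>?P / 2\<close> cancel and the \<open>F\<close> terms
    survive.\<close>
  also have "\<dots> =
     (a + b) / 2 / (2 * (a - b)) * (a ^ 4 * F\<^sub>1 m ?e + a\<^sup>2 * b\<^sup>2 * F\<^sub>1\<^sub>2 m ?e + b ^ 4 * F\<^sub>2 m ?e)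
   + (a - b) / 2 / (2 * (a + b)) * (a ^ 4 * F\<^sub>1 m ?e - a\<^sup>2 * b\<^sup>2 * F\<^sub>1\<^sub>2 m ?e + b ^ 4 * F\<^sub>2 m ?e)
   + (b ^ 4 * F\<^sub>2 m ?e - a ^ 4 * F\<^sub>1 m ?e) / 2"
    unfolding mult_minus_left 4 G \<Gamma> by (simp add: diff_divide_distrib)
  also have "\<dots> = a\<^sup>2 * b\<^sup>2 / ((a + b) * (a - b)) * (a\<^sup>2 * F\<^sub>1 m ?e + a * b * F\<^sub>1\<^sub>2 m ?e + b\<^sup>2 * F\<^sub>2 m ?e)"
    by (rule coeff_LPi[OF a_neq_b a_plus_b])
  finally show "nu q\<^sub>1 \<theta>\<^sub>1 q\<^sub>2 \<theta>\<^sub>2 \<phi> Gs \<Gamma>s m (LPi u) =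
      1 / (of_nat CARD('h) - of_nat CARD('g)) *
        (\<Sum>v\<in>U. bichar q\<^sub>1 u v * of_real ((cmod (gauss_pair q\<^sub>1 q\<^sub>2 \<phi> v (int m)))\<^sup>2))"
    by (simp only: G.ip_sym[of u] gauss_pair_sum)
qed

text \<open>The column has equal entries on the two copies of \<open>U\<close> and vanishes in the
  rows \<open>LGamma\<close>, so the delta term comes from \<open>G\<close> alone, with full weight
  because of the orbit sum.\<close>

lemma nu_LG:
  "nu q\<^sub>1 \<theta>\<^sub>1 q\<^sub>2 \<theta>\<^sub>2 \<phi> Gs \<Gamma>s m (LG g) =
      1 / (of_nat CARD('h) - of_nat CARD('g)) *
        (\<Sum>v\<in>U. bichar q\<^sub>1 g v * of_real ((cmod (gauss_pair q\<^sub>1 q\<^sub>2 \<phi> v (int m)))\<^sup>2))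
      + of_bool (nat_mult m g = 0) * q\<^sub>1 g ^ m" (is "_ = _ + ?P")
proof -
  let ?e = "\<lambda>v. bichar q\<^sub>1 v g"
  let ?f = "\<lambda>x. bichar q\<^sub>1 x g + bichar q\<^sub>1 (\<theta>\<^sub>1 x) g"
  have "(\<Sum>x\<in>Gs. ?f x * sq (G.gauss m x)) = (\<Sum>x\<in>UNIV. ?e x * sq (G.gauss m x)) - F\<^sub>1 m ?e"
    unfolding F\<^sub>1_def by (rule G.sum_half_orbit)
  then have G: "a ^ 4 * (\<Sum>x\<in>Gs. ?f x * sq (G.gauss m x)) = ?P - a ^ 4 * F\<^sub>1 m ?e"
    using sum_ip_gauss_sq_G[of g m] by (simp add: right_diff_distrib)
  have 4: "a * a ^ 3 = a ^ 4"
    by (simp add: eval_nat_numeral)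
  have "nu q\<^sub>1 \<theta>\<^sub>1 q\<^sub>2 \<theta>\<^sub>2 \<phi> Gs \<Gamma>s m (LG g) =
     a / (2 * (a - b)) * (a ^ 4 * F\<^sub>1 m ?e + a\<^sup>2 * b\<^sup>2 * F\<^sub>1\<^sub>2 m ?e + b ^ 4 * F\<^sub>2 m ?e)
   + a / (2 * (a + b)) * (a ^ 4 * F\<^sub>1 m ?e - a\<^sup>2 * b\<^sup>2 * F\<^sub>1\<^sub>2 m ?e + b ^ 4 * F\<^sub>2 m ?e)
   + a * a ^ 3 * (\<Sum>x\<in>Gs. ?f x * sq (G.gauss m x))
   + 0 * b ^ 3 * (\<Sum>\<gamma>\<in>\<Gamma>s. 0 * sq (\<Gamma>.gauss m \<gamma>))"
    by (rule nu_column) (simp_all add: S_bar S_simps del: label_bar.simps)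
  also have "\<dots> = a\<^sup>2 * b\<^sup>2 / ((a + b) * (a - b)) * (a\<^sup>2 * F\<^sub>1 m ?e + a * b * F\<^sub>1\<^sub>2 m ?e + b\<^sup>2 * F\<^sub>2 m ?e) + ?P"
    unfolding 4 G coeff_LG[OF a_neq_b a_plus_b, symmetric]
    by (simp only: mult_zero_left diff_conv_add_uminus add_0_left add_0_right add_ac)
  finally show ?thesis
    by (simp only: G.ip_sym[of g] gauss_pair_sum)
qed

text \<open>Dual to \<open>LG\<close>: the column vanishes in the rows \<open>LG\<close>, and the
  minus sign of the \<Gamma> block of the S-matrix makes the delta term negative.\<close>

lemma nu_LGamma:
  "nu q\<^sub>1 \<theta>\<^sub>1 q\<^sub>2 \<theta>\<^sub>2 \<phi> Gs \<Gamma>s m (LGamma \<gamma>) =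
      1 / (of_nat CARD('h) - of_nat CARD('g)) *
        (\<Sum>v\<in>U. bichar q\<^sub>2 \<gamma> (\<phi> v) * of_real ((cmod (gauss_pair q\<^sub>1 q\<^sub>2 \<phi> v (int m)))\<^sup>2))
      - of_bool (nat_mult m \<gamma> = 0) * q\<^sub>2 \<gamma> ^ m" (is "_ = _ - ?P")
proof -
  let ?e = "\<lambda>v. bichar q\<^sub>2 (\<phi> v) \<gamma>"
  let ?f = "\<lambda>x. bichar q\<^sub>2 x \<gamma> + bichar q\<^sub>2 (\<theta>\<^sub>2 x) \<gamma>"
  have "(\<Sum>x\<in>\<Gamma>s. ?f x * sq (\<Gamma>.gauss m x)) = (\<Sum>x\<in>UNIV. bichar q\<^sub>2 x \<gamma> * sq (\<Gamma>.gauss m x)) - F\<^sub>2 m ?e"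
    unfolding F\<^sub>2_def \<Gamma>.sum_half_orbit by (simp add: sum_fixed_\<phi>)
  then have \<Gamma>: "b ^ 4 * (\<Sum>x\<in>\<Gamma>s. ?f x * sq (\<Gamma>.gauss m x)) = ?P - b ^ 4 * F\<^sub>2 m ?e"
    using sum_ip_gauss_sq_\<Gamma>[of \<gamma> m] by (simp add: right_diff_distrib)
  have 4: "b * b ^ 3 = b ^ 4"
    by (simp add: eval_nat_numeral)
  have "nu q\<^sub>1 \<theta>\<^sub>1 q\<^sub>2 \<theta>\<^sub>2 \<phi> Gs \<Gamma>s m (LGamma \<gamma>) =
     b / (2 * (a - b)) * (a ^ 4 * F\<^sub>1 m ?e + a\<^sup>2 * b\<^sup>2 * F\<^sub>1\<^sub>2 m ?e + b ^ 4 * F\<^sub>2 m ?e)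
   + (- b) / (2 * (a + b)) * (a ^ 4 * F\<^sub>1 m ?e - a\<^sup>2 * b\<^sup>2 * F\<^sub>1\<^sub>2 m ?e + b ^ 4 * F\<^sub>2 m ?e)
   + 0 * a ^ 3 * (\<Sum>x\<in>Gs. 0 * sq (G.gauss m x))
   + (- b) * b ^ 3 * (\<Sum>x\<in>\<Gamma>s. ?f x * sq (\<Gamma>.gauss m x))"
    by (rule nu_column) (simp_all add: S_bar S_simps del: label_bar.simps)
  also have "\<dots> = a\<^sup>2 * b\<^sup>2 / ((a + b) * (a - b)) * (a\<^sup>2 * F\<^sub>1 m ?e + a * b * F\<^sub>1\<^sub>2 m ?e + b\<^sup>2 * F\<^sub>2 m ?e) - ?P"
    unfolding mult_minus_left 4 \<Gamma> coeff_LGamma[OF a_neq_b a_plus_b, symmetric]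
    by (simp only: mult_zero_left minus_divide_left[symmetric] mult_minus_left
        minus_add_distrib minus_minus diff_conv_add_uminus add_0_left add_0_right add_ac)
  finally show ?thesis
    by (simp only: \<Gamma>.ip_sym[of \<gamma>] gauss_pair_sum)
qed

end

theorem lemma3p8:
  fixes q\<^sub>1 :: "'g::{ab_group_add,finite} \<Rightarrow> complex" and \<theta>\<^sub>1 :: "'g \<Rightarrow> 'g"
    and q\<^sub>2 :: "'h::{ab_group_add,finite} \<Rightarrow> complex" and \<theta>\<^sub>2 :: "'h \<Rightarrow> 'h"
    and \<phi> :: "'g \<Rightarrow> 'h" and Gs :: "'g set" and \<Gamma>s :: "'h set" and m :: nat
  assumes "involutive_metric_group q\<^sub>1 \<theta>\<^sub>1"
    and "involutive_metric_group q\<^sub>2 \<theta>\<^sub>2"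
    and "CARD('g) \<noteq> CARD('h)"
    and "gauss_sum q\<^sub>1 = - gauss_sum q\<^sub>2"
    and "metric_iso_on (fixed_points \<theta>\<^sub>1) q\<^sub>1 (fixed_points \<theta>\<^sub>2) q\<^sub>2 \<phi>"
    and "half_of_complement \<theta>\<^sub>1 Gs"
    and "half_of_complement \<theta>\<^sub>2 \<Gamma>s"
  shows "(\<forall>u\<in>fixed_points \<theta>\<^sub>1.
           nu q\<^sub>1 \<theta>\<^sub>1 q\<^sub>2 \<theta>\<^sub>2 \<phi> Gs \<Gamma>s m (LZero u) = of_bool (nat_mult m u = 0) * q\<^sub>1 u ^ m) \<and>
         (\<forall>u\<in>fixed_points \<theta>\<^sub>1.
           nu q\<^sub>1 \<theta>\<^sub>1 q\<^sub>2 \<theta>\<^sub>2 \<phi> Gs \<Gamma>s m (LPi u) =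
             1 / (of_nat CARD('h) - of_nat CARD('g)) *
             (\<Sum>v\<in>fixed_points \<theta>\<^sub>1.
                bichar q\<^sub>1 u v * of_real ((cmod (gauss_pair q\<^sub>1 q\<^sub>2 \<phi> v (int m)))\<^sup>2))) \<and>
         (\<forall>g\<in>Gs.
           nu q\<^sub>1 \<theta>\<^sub>1 q\<^sub>2 \<theta>\<^sub>2 \<phi> Gs \<Gamma>s m (LG g) =
             1 / (of_nat CARD('h) - of_nat CARD('g)) *
             (\<Sum>v\<in>fixed_points \<theta>\<^sub>1.
                bichar q\<^sub>1 g v * of_real ((cmod (gauss_pair q\<^sub>1 q\<^sub>2 \<phi> v (int m)))\<^sup>2))
             + of_bool (nat_mult m g = 0) * q\<^sub>1 g ^ m) \<and>
         (\<forall>\<gamma>\<in>\<Gamma>s.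
           nu q\<^sub>1 \<theta>\<^sub>1 q\<^sub>2 \<theta>\<^sub>2 \<phi> Gs \<Gamma>s m (LGamma \<gamma>) =
             1 / (of_nat CARD('h) - of_nat CARD('g)) *
             (\<Sum>v\<in>fixed_points \<theta>\<^sub>1.
                bichar q\<^sub>2 \<gamma> (\<phi> v) * of_real ((cmod (gauss_pair q\<^sub>1 q\<^sub>2 \<phi> v (int m)))\<^sup>2))
             - of_bool (nat_mult m \<gamma> = 0) * q\<^sub>2 \<gamma> ^ m)"
proof -
  interpret involutive_pair q\<^sub>1 \<theta>\<^sub>1 Gs q\<^sub>2 \<theta>\<^sub>2 \<Gamma>s \<phi>
    by unfold_locales (use assms in auto)
  show ?thesis
    by (auto simp: nu_LZero_LPi nu_LG nu_LGamma)
qed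

end
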